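(* Let $C$ be a unitary modular tensor category, let $q\in\mathrm{Gal}(K_C)$ be such that $q(C)$ is also unitary, let $\mathcal{A}=\oplus_i n_i a_i$ be a Lagrangian algebra in $C$ defining a (bosonic) gapped boundary of the bulk TQFT, and consider the gapped boundary of $q(C)$ defined by the corresponding Galois conjugate Lagrangian algebra, which has the same underlying object $\oplus_i n_i a_i$. Then the fusion rules of the boundary excitations are invariant under the Galois conjugation: there is a bijection between the simple boundary excitations of the two gapped boundaries under which the boundary fusion coefficients $n_{xy}^z$ coincide.
   Context: A modular tensor category (MTC) $C$ (with simple objects called anyons) is described, after choosing bases of the fusion spaces $V_{ab}^c$ (such a choice is called a gauge), by its $F$ symbols (associativity matrices), $R$ symbols (braiding matrices) and pivotal coefficients $\epsilon_a\in\{\pm1\}$. There is always a gauge in which all entries of $F$ and $R$ lie in a number field; fix such a gauge. The defining number field $K_C$ is the normal closure over $\mathbb{Q}$ of $\mathbb{Q}(F,R)$. For $q\in\mathrm{Gal}(K_C):=\mathrm{Gal}(K_C/\mathbb{Q})$, the Galois conjugate $q(C)$ is the MTC with the same anyons, fusion rules and $\epsilon_a$, and with data $q(F),q(R)$. An MTC is unitary if there is a gauge in which all its $F$ and $R$ matrices are unitary and all quantum dimensions are positive; a Galois conjugation taking a unitary MTC to a unitary MTC is called unitarity-preserving. A Lagrangian algebra in $C$ is a connected commutative separable algebra $\mathcal{A}$ in $C$ with $\dim(\mathcal{A})^2=\dim(C)$. Bosonic gapped boundaries of the TQFT of $C$ correspond to condensation of Lagrangian algebras in $C$; the boundary excitations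 form a fusion category, namely the idempotent completion of the quotient $C/\mathcal{A}$ (equivalently the category of $\mathcal{A}$-modules in $C$), with simple objects $x,y,z,\dots$ and fusion rules $x\otimes y=\sum_z n_{xy}^z z$. The anyons forming a Lagrangian algebra in $C$ also form a Lagrangian algebra in $q(C)$, and this is the boundary of $q(C)$ being compared. *)

theory Defs
  imports
    "HOL-Analysis.Analysis"
    "HOL-Library.Groups_Big_Fun"
    "HOL-Computational_Algebra.Polynomial"
begin

section \<open>Skeletal data of a modular tensor category\<close>

text \<open>
  The anyons are the elements of a finite type. For anyons \<open>a b c\<close> the space
  \<open>Hom(c, a \<otimes> b)\<close> has the chosen basis \<open>|a,b;c,\<mu>\<rangle>\<close> with \<open>\<mu> < Nfus a b c\<close>.

  \<open>Fsym a b c d (e,\<alpha>,\<beta>) (f,\<mu>,\<nu>)\<close> is the coefficient of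
  \<open>(id_a \<otimes> |b,c;f,\<mu>\<rangle>) \<circ> |a,f;d,\<nu>\<rangle>\<close> in the image of \<open>(|a,b;e,\<alpha>\<rangle> \<otimes> id_c) \<circ> |e,c;d,\<beta>\<rangle>\<close>
  under the associator \<open>(a \<otimes> b) \<otimes> c \<rightarrow> a \<otimes> (b \<otimes> c)\<close>.

  \<open>Rsym a b c \<mu> \<nu>\<close> is the coefficient of \<open>|b,a;c,\<nu>\<rangle>\<close> in the image of \<open>|a,b;c,\<mu>\<rangle>\<close> under the
  braiding \<open>a \<otimes> b \<rightarrow> b \<otimes> a\<close>.

  The values of \<open>Fsym\<close> and \<open>Rsym\<close> outside the index ranges below are irrelevant and never used.
\<close>

record 'a mtc_data =
  vac :: 'a
  Nfus :: "'a \<Rightarrow> 'a \<Rightarrow> 'a \<Rightarrow> nat"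
  Fsym :: "'a \<Rightarrow> 'a \<Rightarrow> 'a \<Rightarrow> 'a \<Rightarrow> 'a \<times> nat \<times> nat \<Rightarrow> 'a \<times> nat \<times> nat \<Rightarrow> complex"
  Rsym :: "'a \<Rightarrow> 'a \<Rightarrow> 'a \<Rightarrow> nat \<Rightarrow> nat \<Rightarrow> complex"
  piv :: "'a \<Rightarrow> complex"

definition ltrees :: "'a mtc_data \<Rightarrow> 'a \<Rightarrow> 'a \<Rightarrow> 'a \<Rightarrow> 'a \<Rightarrow> ('a \<times> nat \<times> nat) set" where
  "ltrees C a b c d = {(e, \<alpha>, \<beta>). \<alpha> < Nfus C a b e \<and> \<beta> < Nfus C e c d}"

definition rtrees :: "'a mtc_data \<Rightarrow> 'a \<Rightarrow> 'a \<Rightarrow> 'a \<Rightarrow> 'a \<Rightarrow> ('a \<times> nat \<times> nat) set" where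
  "rtrees C a b c d = {(f, \<mu>, \<nu>). \<mu> < Nfus C b c f \<and> \<nu> < Nfus C a f d}"

definition dual :: "'a mtc_data \<Rightarrow> 'a \<Rightarrow> 'a" where
  "dual C a = (THE b. Nfus C a b (vac C) \<noteq> 0)"

text \<open>
  The quantum dimension: with the dualities normalised by the chosen bases of
  \<open>Hom(1, a \<otimes> a*)\<close> and of \<open>Hom(1, a* \<otimes> a)\<close>, the zig-zag composite on \<open>a\<close> is the scalar
  in the denominator.
\<close>

definition qdim :: "'a mtc_data \<Rightarrow> 'a \<Rightarrow> complex" where
  "qdim C a = piv C a / Fsym C a (dual C a) a a (vac C, 0, 0) (vac C, 0, 0)"

definition global_dim :: "'a::finite mtc_data \<Rightarrow> complex" where
  "global_dim C = (\<Sum>a\<in>UNIV. (qdim C a)\<^sup>2)"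


section \<open>The category presented by the data\<close>

text \<open>
  An object \<open>X\<close> stands for the finite direct sum of anyons in which \<open>a\<close> has one copy for every
  index in \<open>X a\<close>. The index \<open>Nd a b i j \<mu>\<close> of \<open>X \<otimes> Y\<close> at \<open>c\<close> labels the copy of \<open>c\<close> embedded by
  \<open>|a,b;c,\<mu>\<rangle>\<close> into the tensor product of the copy \<open>i\<close> of \<open>a\<close> in \<open>X\<close> and the copy \<open>j\<close> of \<open>b\<close>
  in \<open>Y\<close>.

  A morphism \<open>f : X \<rightarrow> Y\<close> is a block matrix: \<open>f a i j\<close> is its entry from the copy \<open>j \<in> X a\<close> to the
  copy \<open>i \<in> Y a\<close>, and all other entries are zero.
\<close>

datatype 'a idx = Pt nat | Nd 'a 'a "'a idx" "'a idx" nat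

type_synonym 'a obj = "'a \<Rightarrow> 'a idx set"
type_synonym 'a mor = "'a \<Rightarrow> 'a idx \<Rightarrow> 'a idx \<Rightarrow> complex"

definition is_obj :: "'a obj \<Rightarrow> bool" where
  "is_obj X \<longleftrightarrow> (\<forall>a. finite (X a))"

definition hom :: "'a obj \<Rightarrow> 'a obj \<Rightarrow> 'a mor set" where
  "hom X Y = {f. \<forall>a i j. f a i j \<noteq> 0 \<longrightarrow> i \<in> Y a \<and> j \<in> X a}"

definition idm :: "'a obj \<Rightarrow> 'a mor" where
  "idm X = (\<lambda>a i j. if i = j \<and> i \<in> X a then 1 else 0)"

definition zerom :: "'a mor" where
  "zerom = (\<lambda>a i j. 0)"

definition comp :: "'a mor \<Rightarrow> 'a mor \<Rightarrow> 'a mor"  (infixr "\<odot>" 70) where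
  "g \<odot> f = (\<lambda>a i k. Sum_any (\<lambda>j. g a i j * f a j k))"

definition iso_mor :: "'a obj \<Rightarrow> 'a obj \<Rightarrow> 'a mor \<Rightarrow> bool" where
  "iso_mor X Y f \<longleftrightarrow> f \<in> hom X Y \<and> (\<exists>g \<in> hom Y X. g \<odot> f = idm X \<and> f \<odot> g = idm Y)"

definition inv_mor :: "'a obj \<Rightarrow> 'a obj \<Rightarrow> 'a mor \<Rightarrow> 'a mor" where
  "inv_mor X Y f = (THE g. g \<in> hom Y X \<and> g \<odot> f = idm X \<and> f \<odot> g = idm Y)"

definition simp_obj :: "'a \<Rightarrow> 'a obj" where
  "simp_obj a = (\<lambda>b. if b = a then {Pt 0} else {})"

abbreviation unit_obj :: "'a mtc_data \<Rightarrow> 'a obj" where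
  "unit_obj C \<equiv> simp_obj (vac C)"

definition tens :: "'a mtc_data \<Rightarrow> 'a obj \<Rightarrow> 'a obj \<Rightarrow> 'a obj" where
  "tens C X Y = (\<lambda>c. {Nd a b i j \<mu> | a b i j \<mu>. i \<in> X a \<and> j \<in> Y b \<and> \<mu> < Nfus C a b c})"

fun tensm :: "'a mtc_data \<Rightarrow> 'a mor \<Rightarrow> 'a mor \<Rightarrow> 'a mor" where
  "tensm C f g c (Nd a b i j \<mu>) (Nd a' b' i' j' \<mu>') =
     (if a' = a \<and> b' = b \<and> \<mu>' = \<mu> \<and> \<mu> < Nfus C a b c then f a i i' * g b j j' else 0)"
| "tensm C f g c _ _ = 0"

fun F_entry :: "'a mtc_data \<Rightarrow> 'a mor" where
  "F_entry C d (Nd a' f i' (Nd b' c' j' k' \<mu>) \<nu>) (Nd e c (Nd a b i j \<alpha>) k \<beta>) =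
     (if a' = a \<and> b' = b \<and> c' = c \<and> i' = i \<and> j' = j \<and> k' = k
      then Fsym C a b c d (e, \<alpha>, \<beta>) (f, \<mu>, \<nu>) else 0)"
| "F_entry C d _ _ = 0"

definition assoc :: "'a mtc_data \<Rightarrow> 'a obj \<Rightarrow> 'a obj \<Rightarrow> 'a obj \<Rightarrow> 'a mor" where
  "assoc C X Y Z = (\<lambda>d r s. if r \<in> tens C X (tens C Y Z) d \<and> s \<in> tens C (tens C X Y) Z d
                            then F_entry C d r s else 0)"

abbreviation assoc_inv :: "'a mtc_data \<Rightarrow> 'a obj \<Rightarrow> 'a obj \<Rightarrow> 'a obj \<Rightarrow> 'a mor" where
  "assoc_inv C X Y Z \<equiv> inv_mor (tens C (tens C X Y) Z) (tens C X (tens C Y Z)) (assoc C X Y Z)"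

fun R_entry :: "'a mtc_data \<Rightarrow> 'a mor" where
  "R_entry C c (Nd b' a' j' i' \<nu>) (Nd a b i j \<mu>) =
     (if a' = a \<and> b' = b \<and> i' = i \<and> j' = j then Rsym C a b c \<mu> \<nu> else 0)"
| "R_entry C c _ _ = 0"

definition braid :: "'a mtc_data \<Rightarrow> 'a obj \<Rightarrow> 'a obj \<Rightarrow> 'a mor" where
  "braid C X Y = (\<lambda>c r s. if r \<in> tens C Y X c \<and> s \<in> tens C X Y c then R_entry C c r s else 0)"

text \<open>The basis vectors \<open>|1,a;a,0\<rangle>\<close> and \<open>|a,1;a,0\<rangle>\<close> are taken to be the inverse unitors.\<close>

definition lunit :: "'a mtc_data \<Rightarrow> 'a obj \<Rightarrow> 'a mor" where
  "lunit C X = (\<lambda>a i r. if i \<in> X a \<and> r = Nd (vac C) a (Pt 0) i 0 then 1 else 0)"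

definition runit :: "'a mtc_data \<Rightarrow> 'a obj \<Rightarrow> 'a mor" where
  "runit C X = (\<lambda>a i r. if i \<in> X a \<and> r = Nd a (vac C) i (Pt 0) 0 then 1 else 0)"

definition obj_dim :: "'a::finite mtc_data \<Rightarrow> 'a obj \<Rightarrow> complex" where
  "obj_dim C X = (\<Sum>a\<in>UNIV. of_nat (card (X a)) * qdim C a)"

definition qtrace :: "'a::finite mtc_data \<Rightarrow> 'a obj \<Rightarrow> 'a mor \<Rightarrow> complex" where
  "qtrace C X f = (\<Sum>a\<in>UNIV. qdim C a * (\<Sum>i\<in>X a. f a i i))"

definition S_matrix :: "'a::finite mtc_data \<Rightarrow> complex^'a^'a" where
  "S_matrix C = (\<chi> a b. qtrace C (tens C (simp_obj a) (simp_obj b))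
     (braid C (simp_obj b) (simp_obj a) \<odot> braid C (simp_obj a) (simp_obj b)))"


section \<open>Modular tensor categories\<close>

definition fusion_axioms :: "'a mtc_data \<Rightarrow> bool" where
  "fusion_axioms C \<longleftrightarrow>
     (\<forall>a b. Nfus C (vac C) a b = of_bool (a = b) \<and> Nfus C a (vac C) b = of_bool (a = b)) \<and>
     (\<forall>a. \<exists>b. \<forall>c. Nfus C a c (vac C) = of_bool (c = b) \<and> Nfus C c a (vac C) = of_bool (c = b))"

definition monoidal_axioms :: "'a mtc_data \<Rightarrow> bool" where
  "monoidal_axioms C \<longleftrightarrow>
     (\<forall>a b c. let X = simp_obj a; Y = simp_obj b; Z = simp_obj c in
        iso_mor (tens C (tens C X Y) Z) (tens C X (tens C Y Z)) (assoc C X Y Z)) \<and>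
     (\<forall>a b c d. let W = simp_obj a; X = simp_obj b; Y = simp_obj c; Z = simp_obj d in
        assoc C W X (tens C Y Z) \<odot> assoc C (tens C W X) Y Z =
        tensm C (idm W) (assoc C X Y Z) \<odot> assoc C W (tens C X Y) Z \<odot>
          tensm C (assoc C W X Y) (idm Z)) \<and>
     (\<forall>a b. let X = simp_obj a; Y = simp_obj b in
        tensm C (idm X) (lunit C Y) \<odot> assoc C X (unit_obj C) Y = tensm C (runit C X) (idm Y))"

definition braiding_axioms :: "'a mtc_data \<Rightarrow> bool" where
  "braiding_axioms C \<longleftrightarrow>
     (\<forall>a b. let X = simp_obj a; Y = simp_obj b in
        iso_mor (tens C X Y) (tens C Y X) (braid C X Y)) \<and>
     (\<forall>a b c. let X = simp_obj a; Y = simp_obj b; Z = simp_obj c in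
        assoc C Y Z X \<odot> braid C X (tens C Y Z) \<odot> assoc C X Y Z =
        tensm C (idm Y) (braid C X Z) \<odot> assoc C Y X Z \<odot> tensm C (braid C X Y) (idm Z)) \<and>
     (\<forall>a b c. let X = simp_obj a; Y = simp_obj b; Z = simp_obj c in
        assoc_inv C Z X Y \<odot> braid C (tens C X Y) Z \<odot> assoc_inv C X Y Z =
        tensm C (braid C X Z) (idm Y) \<odot> assoc_inv C X Z Y \<odot> tensm C (idm X) (braid C Y Z))"

text \<open>
  In the pivotal axiom, the composite of the three \<open>F\<close>-moves
  \<open>(ab)c* \<rightarrow> a(bc*)\<close>, \<open>(bc*)a \<rightarrow> b(c*a)\<close>, \<open>(c*a)b \<rightarrow> c*(ab)\<close> into the vacuum is the double dual on
  \<open>Hom(c, a \<otimes> b)\<close>; the pivotal structure makes it the scalar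
  \<open>\<epsilon>_a \<epsilon>_b / \<epsilon>_c = \<epsilon>_a \<epsilon>_b \<epsilon>_c\<close>. Sphericality is the equality of the dimensions of an anyon and of
  its dual.
\<close>

definition spherical_axioms :: "'a::finite mtc_data \<Rightarrow> bool" where
  "spherical_axioms C \<longleftrightarrow>
     (\<forall>a. Fsym C a (dual C a) a a (vac C, 0, 0) (vac C, 0, 0) \<noteq> 0) \<and>
     (\<forall>a. piv C a \<in> {1, -1}) \<and>
     piv C (vac C) = 1 \<and>
     (\<forall>a. piv C (dual C a) = piv C a) \<and>
     (\<forall>a b c. \<forall>\<alpha> < Nfus C a b c. \<forall>\<alpha>' < Nfus C a b c.
        (\<Sum>\<beta> < Nfus C b (dual C c) (dual C a). \<Sum>\<gamma> < Nfus C (dual C c) a (dual C b).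
           Fsym C a b (dual C c) (vac C) (c, \<alpha>, 0) (dual C a, \<beta>, 0) *
           Fsym C b (dual C c) a (vac C) (dual C a, \<beta>, 0) (dual C b, \<gamma>, 0) *
           Fsym C (dual C c) a b (vac C) (dual C b, \<gamma>, 0) (c, \<alpha>', 0)) =
        (if \<alpha> = \<alpha>' then piv C a * piv C b * piv C c else 0)) \<and>
     (\<forall>a. qdim C (dual C a) = qdim C a)"

definition mtc :: "'a::finite mtc_data \<Rightarrow> bool" where
  "mtc C \<longleftrightarrow> fusion_axioms C \<and> monoidal_axioms C \<and> braiding_axioms C \<and> spherical_axioms C \<and>
     det (S_matrix C) \<noteq> 0"


section \<open>Gauge transformations and unitarity\<close>

text \<open>
  A gauge transformation replaces \<open>|a,b;c,\<mu>\<rangle>\<close> by \<open>\<Sum>\<mu>'. u a b c \<mu> \<mu>' |a,b;c,\<mu>'\<rangle>\<close>; here \<open>v a b c\<close> is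
  the inverse of the matrix \<open>u a b c\<close>. The basis vectors identified with the unitors are kept.
\<close>

definition gauge ::
  "'a mtc_data \<Rightarrow> ('a \<Rightarrow> 'a \<Rightarrow> 'a \<Rightarrow> nat \<Rightarrow> nat \<Rightarrow> complex) \<Rightarrow>
     ('a \<Rightarrow> 'a \<Rightarrow> 'a \<Rightarrow> nat \<Rightarrow> nat \<Rightarrow> complex) \<Rightarrow> bool" where
  "gauge C u v \<longleftrightarrow>
     (\<forall>a b c. \<forall>\<mu> < Nfus C a b c. \<forall>\<nu> < Nfus C a b c.
        (\<Sum>\<kappa> < Nfus C a b c. u a b c \<mu> \<kappa> * v a b c \<kappa> \<nu>) = of_bool (\<mu> = \<nu>) \<and>
        (\<Sum>\<kappa> < Nfus C a b c. v a b c \<mu> \<kappa> * u a b c \<kappa> \<nu>) = of_bool (\<mu> = \<nu>)) \<and>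
     (\<forall>a. u (vac C) a a 0 0 = 1 \<and> u a (vac C) a 0 0 = 1)"

definition gauged_F where
  "gauged_F C u v a b c d = (\<lambda>(e, \<alpha>, \<beta>) (f, \<mu>, \<nu>).
     \<Sum>\<alpha>' < Nfus C a b e. \<Sum>\<beta>' < Nfus C e c d. \<Sum>\<mu>' < Nfus C b c f. \<Sum>\<nu>' < Nfus C a f d.
       u a b e \<alpha> \<alpha>' * u e c d \<beta> \<beta>' * Fsym C a b c d (e, \<alpha>', \<beta>') (f, \<mu>', \<nu>') *
       v b c f \<mu>' \<mu> * v a f d \<nu>' \<nu>)"

definition gauged_R where
  "gauged_R C u v a b c = (\<lambda>\<mu> \<nu>.
     \<Sum>\<mu>' < Nfus C a b c. \<Sum>\<nu>' < Nfus C b a c.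
       u a b c \<mu> \<mu>' * Rsym C a b c \<mu>' \<nu>' * v b a c \<nu>' \<nu>)"

definition unitary_matrix :: "'i set \<Rightarrow> 'j set \<Rightarrow> ('i \<Rightarrow> 'j \<Rightarrow> complex) \<Rightarrow> bool" where
  "unitary_matrix I J M \<longleftrightarrow>
     (\<forall>i\<in>I. \<forall>i'\<in>I. (\<Sum>j\<in>J. M i j * cnj (M i' j)) = of_bool (i = i')) \<and>
     (\<forall>j\<in>J. \<forall>j'\<in>J. (\<Sum>i\<in>I. cnj (M i j) * M i j') = of_bool (j = j'))"

text \<open>
  The pivotal coefficients change with the gauge in such a way that the quantum dimensions do not;
  so the latter are computed from the given data.
\<close>

definition unitary_mtc :: "'a::finite mtc_data \<Rightarrow> bool" where
  "unitary_mtc C \<longleftrightarrow> mtc C \<and>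
     (\<exists>u v. gauge C u v \<and>
        (\<forall>a b c d. unitary_matrix (ltrees C a b c d) (rtrees C a b c d) (gauged_F C u v a b c d)) \<and>
        (\<forall>a b c. unitary_matrix {..<Nfus C a b c} {..<Nfus C b a c} (gauged_R C u v a b c))) \<and>
     (\<forall>a. qdim C a \<in> \<real> \<and> Re (qdim C a) > 0)"


section \<open>The defining number field and Galois conjugation\<close>

definition is_subfield :: "complex set \<Rightarrow> bool" where
  "is_subfield K \<longleftrightarrow> 0 \<in> K \<and> 1 \<in> K \<and>
     (\<forall>x\<in>K. \<forall>y\<in>K. x + y \<in> K \<and> x * y \<in> K) \<and> (\<forall>x\<in>K. - x \<in> K \<and> inverse x \<in> K)"

definition number_field :: "complex set \<Rightarrow> bool" where
  "number_field K \<longleftrightarrow> is_subfield K \<and>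
     (\<exists>B. finite B \<and> B \<subseteq> K \<and> (\<forall>x\<in>K. \<exists>r :: complex \<Rightarrow> rat. x = (\<Sum>b\<in>B. of_rat (r b) * b)))"

definition normal_over_rat :: "complex set \<Rightarrow> bool" where
  "normal_over_rat K \<longleftrightarrow>
     (\<forall>p :: rat poly. irreducible p \<and> (\<exists>x\<in>K. poly (map_poly of_rat p) x = 0) \<longrightarrow>
        (\<forall>z :: complex. poly (map_poly of_rat p) z = 0 \<longrightarrow> z \<in> K))"

definition FR_entries :: "'a mtc_data \<Rightarrow> complex set" where
  "FR_entries C =
     {Fsym C a b c d s t | a b c d s t. s \<in> ltrees C a b c d \<and> t \<in> rtrees C a b c d} \<union>
     {Rsym C a b c \<mu> \<nu> | a b c \<mu> \<nu>. \<mu> < Nfus C a b c \<and> \<nu> < Nfus C b a c}"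

definition FR_field :: "'a mtc_data \<Rightarrow> complex set" where
  "FR_field C = is_subfield hull FR_entries C"

definition defining_field :: "'a mtc_data \<Rightarrow> complex set" where
  "defining_field C = (\<lambda>K. is_subfield K \<and> normal_over_rat K) hull FR_field C"

text \<open>Values of \<open>q\<close> outside \<open>K\<close> are irrelevant.\<close>

definition Gal :: "complex set \<Rightarrow> (complex \<Rightarrow> complex) set" where
  "Gal K = {q. bij_betw q K K \<and> (\<forall>x\<in>K. \<forall>y\<in>K. q (x + y) = q x + q y \<and> q (x * y) = q x * q y) \<and>
     (\<forall>r. q (of_rat r) = of_rat r)}"

definition galois_conj :: "(complex \<Rightarrow> complex) \<Rightarrow> 'a mtc_data \<Rightarrow> 'a mtc_data" where
  "galois_conj q C = C\<lparr>Fsym := (\<lambda>a b c d s t. q (Fsym C a b c d s t)),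
                      Rsym := (\<lambda>a b c \<mu> \<nu>. q (Rsym C a b c \<mu> \<nu>))\<rparr>"


section \<open>Lagrangian algebras\<close>

record 'a alg =
  carr :: "'a obj"
  mult :: "'a mor"
  unt :: "'a mor"

definition algebra :: "'a mtc_data \<Rightarrow> 'a alg \<Rightarrow> bool" where
  "algebra C A \<longleftrightarrow> is_obj (carr A) \<and>
     mult A \<in> hom (tens C (carr A) (carr A)) (carr A) \<and>
     unt A \<in> hom (unit_obj C) (carr A) \<and>
     mult A \<odot> tensm C (mult A) (idm (carr A)) =
       mult A \<odot> tensm C (idm (carr A)) (mult A) \<odot> assoc C (carr A) (carr A) (carr A) \<and>
     mult A \<odot> tensm C (unt A) (idm (carr A)) = lunit C (carr A) \<and>
     mult A \<odot> tensm C (idm (carr A)) (unt A) = runit C (carr A)"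

definition commutative_alg :: "'a mtc_data \<Rightarrow> 'a alg \<Rightarrow> bool" where
  "commutative_alg C A \<longleftrightarrow> mult A \<odot> braid C (carr A) (carr A) = mult A"

text \<open>Connected: \<open>Hom(1, A)\<close> is one-dimensional; its dimension is the multiplicity of the vacuum.\<close>

definition connected_alg :: "'a mtc_data \<Rightarrow> 'a alg \<Rightarrow> bool" where
  "connected_alg C A \<longleftrightarrow> card (carr A (vac C)) = 1"

text \<open>Separable: the multiplication has a section that is a morphism of bimodules.\<close>

definition separable_alg :: "'a mtc_data \<Rightarrow> 'a alg \<Rightarrow> bool" where
  "separable_alg C A \<longleftrightarrow> (let X = carr A; m = mult A in
     \<exists>s \<in> hom X (tens C X X).
       m \<odot> s = idm X \<and>
       tensm C (idm X) m \<odot> assoc C X X X \<odot> tensm C s (idm X) = s \<odot> m \<and>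
       tensm C m (idm X) \<odot> assoc_inv C X X X \<odot> tensm C (idm X) s = s \<odot> m)"

definition lagrangian_algebra :: "'a::finite mtc_data \<Rightarrow> 'a alg \<Rightarrow> bool" where
  "lagrangian_algebra C A \<longleftrightarrow> algebra C A \<and> connected_alg C A \<and> commutative_alg C A \<and>
     separable_alg C A \<and> (obj_dim C (carr A))\<^sup>2 = global_dim C"

text \<open>
  The structure constants of an algebra need not lie in the defining field. A Galois conjugate of
  \<open>A\<close> along \<open>q\<close> is obtained by applying to them an automorphism of the complex numbers extending
  \<open>q\<close>; the underlying object does not change.
\<close>

definition galois_conj_alg ::
  "(complex \<Rightarrow> complex) \<Rightarrow> 'a mtc_data \<Rightarrow> 'a alg \<Rightarrow> 'a alg \<Rightarrow> bool" where
  "galois_conj_alg q C A B \<longleftrightarrow>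
     (\<exists>\<sigma> \<in> Gal UNIV. (\<forall>x \<in> defining_field C. \<sigma> x = q x) \<and>
        carr B = carr A \<and>
        mult B = (\<lambda>a i j. \<sigma> (mult A a i j)) \<and>
        unt B = (\<lambda>a i j. \<sigma> (unt A a i j)))"


section \<open>Boundary excitations\<close>

record 'a amod =
  mcarr :: "'a obj"
  act :: "'a mor"

definition amodule :: "'a mtc_data \<Rightarrow> 'a alg \<Rightarrow> 'a amod \<Rightarrow> bool" where
  "amodule C A M \<longleftrightarrow> is_obj (mcarr M) \<and>
     act M \<in> hom (tens C (carr A) (mcarr M)) (mcarr M) \<and>
     act M \<odot> tensm C (mult A) (idm (mcarr M)) =
       act M \<odot> tensm C (idm (carr A)) (act M) \<odot> assoc C (carr A) (carr A) (mcarr M) \<and>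
     act M \<odot> tensm C (unt A) (idm (mcarr M)) = lunit C (mcarr M)"

definition mod_hom :: "'a mtc_data \<Rightarrow> 'a alg \<Rightarrow> 'a amod \<Rightarrow> 'a amod \<Rightarrow> 'a mor set" where
  "mod_hom C A M N = {f \<in> hom (mcarr M) (mcarr N).
     f \<odot> act M = act N \<odot> tensm C (idm (carr A)) f}"

definition mod_iso :: "'a mtc_data \<Rightarrow> 'a alg \<Rightarrow> 'a amod \<Rightarrow> 'a amod \<Rightarrow> 'a mor \<Rightarrow> bool" where
  "mod_iso C A M N f \<longleftrightarrow> f \<in> mod_hom C A M N \<and>
     (\<exists>g \<in> mod_hom C A N M. g \<odot> f = idm (mcarr M) \<and> f \<odot> g = idm (mcarr N))"

definition mod_mono :: "'a mtc_data \<Rightarrow> 'a alg \<Rightarrow> 'a amod \<Rightarrow> 'a amod \<Rightarrow> 'a mor \<Rightarrow> bool" where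
  "mod_mono C A M N f \<longleftrightarrow> f \<in> mod_hom C A M N \<and>
     (\<forall>K. amodule C A K \<longrightarrow>
        (\<forall>g \<in> mod_hom C A K M. \<forall>h \<in> mod_hom C A K M. f \<odot> g = f \<odot> h \<longrightarrow> g = h))"

definition simple_module :: "'a mtc_data \<Rightarrow> 'a alg \<Rightarrow> 'a amod \<Rightarrow> bool" where
  "simple_module C A M \<longleftrightarrow> amodule C A M \<and> idm (mcarr M) \<noteq> zerom \<and>
     (\<forall>N f. amodule C A N \<and> mod_mono C A N M f \<longrightarrow> f = zerom \<or> mod_iso C A N M f)"

definition simple_excitations :: "'a mtc_data \<Rightarrow> 'a alg \<Rightarrow> 'a amod set set" where
  "simple_excitations C A = {M. simple_module C A M} //
     {(M, N). simple_module C A M \<and> simple_module C A N \<and> (\<exists>f. mod_iso C A M N f)}"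

text \<open>
  The tensor product over \<open>A\<close> is the coequaliser \<open>p : M \<otimes> N \<rightarrow> T\<close> of the two actions
  \<open>(A \<otimes> M) \<otimes> N \<rightarrow> M \<otimes> N\<close>, where \<open>A\<close> acts on \<open>N\<close> after being braided past \<open>M\<close>, with the action
  of \<open>A\<close> induced by the one on \<open>M\<close>.
\<close>

definition tensor_over ::
  "'a mtc_data \<Rightarrow> 'a alg \<Rightarrow> 'a amod \<Rightarrow> 'a amod \<Rightarrow> 'a amod \<Rightarrow> 'a mor \<Rightarrow> bool" where
  "tensor_over C A M N T p \<longleftrightarrow>
     (let X = carr A; V = mcarr M; W = mcarr N;
          l = tensm C (act M) (idm W);
          r = tensm C (idm V) (act N) \<odot> assoc C V X W \<odot> tensm C (braid C X V) (idm W)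
      in amodule C A T \<and> p \<in> hom (tens C V W) (mcarr T) \<and> p \<odot> l = p \<odot> r \<and>
         (\<forall>Z. is_obj Z \<longrightarrow> (\<forall>h \<in> hom (tens C V W) Z. h \<odot> l = h \<odot> r \<longrightarrow>
            (\<exists>!k. k \<in> hom (mcarr T) Z \<and> k \<odot> p = h))) \<and>
         act T \<odot> tensm C (idm X) p \<odot> assoc C X V W = p \<odot> l)"

definition direct_sum_of :: "'a mtc_data \<Rightarrow> 'a alg \<Rightarrow> 'a amod list \<Rightarrow> 'a amod \<Rightarrow> bool" where
  "direct_sum_of C A Ms T \<longleftrightarrow>
     (\<exists>\<iota> \<pi>. (\<forall>k < length Ms. \<iota> k \<in> mod_hom C A (Ms ! k) T \<and> \<pi> k \<in> mod_hom C A T (Ms ! k)) \<and>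
        (\<forall>k < length Ms. \<forall>l < length Ms.
           \<pi> k \<odot> \<iota> l = (if k = l then idm (mcarr (Ms ! k)) else zerom)) \<and>
        (\<lambda>a i j. \<Sum>k < length Ms. (\<iota> k \<odot> \<pi> k) a i j) = idm (mcarr T))"

text \<open>
  The coefficient \<open>n_xy^z\<close>: the number of summands in the class \<open>z\<close> when the product over \<open>A\<close> of
  modules in the classes \<open>x\<close> and \<open>y\<close> is decomposed into simple modules. Such a decomposition exists
  as \<open>A\<close> is separable, and the number is unique by the Krull-Schmidt theorem.
\<close>

definition boundary_fusion ::
  "'a mtc_data \<Rightarrow> 'a alg \<Rightarrow> 'a amod set \<Rightarrow> 'a amod set \<Rightarrow> 'a amod set \<Rightarrow> nat" where
  "boundary_fusion C A x y z =
     (THE n. \<exists>M \<in> x. \<exists>N \<in> y. \<exists>T p Ms. tensor_over C A M N T p \<and>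
        (\<forall>L \<in> set Ms. simple_module C A L) \<and> direct_sum_of C A Ms T \<and>
        n = card {k. k < length Ms \<and> Ms ! k \<in> z})"

end

theory Submission
  imports Defs
begin

text \<open>
  All notions involved are algebraic over the complex numbers, so entrywise application of the field
  automorphism \<open>\<sigma>\<close> extending \<open>q\<close> is an isomorphism from the structure \<open>(C, A)\<close> to
  \<open>(q(C), B)\<close>. It maps modules to modules, and preserves simplicity, products over the algebra and
  direct sums. Two points need care: the data of \<open>q(C)\<close> is \<open>\<sigma>\<close> of the data of \<open>C\<close> only inside the
  index ranges of the fusion spaces, and inverse associators are given by a definite description,
  so that their existence on arbitrary objects has to be derived from that on simple ones.
\<close>

section \<open>Inverse associators\<close>

lemma is_obj_tens:
  fixes C :: "'a::finite mtc_data"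
  assumes "is_obj X" "is_obj Y"
  shows "is_obj (tens C X Y)"
  unfolding is_obj_def
proof
  fix c
  have "tens C X Y c \<subseteq> (\<Union>a. \<Union>b. (\<lambda>(i, j, \<mu>). Nd a b i j \<mu>) ` (X a \<times> Y b \<times> {..<Nfus C a b c}))"
  proof
    fix r assume "r \<in> tens C X Y c"
    then obtain a b i j \<mu> where r: "r = Nd a b i j \<mu>" "i \<in> X a" "j \<in> Y b" "\<mu> < Nfus C a b c"
      unfolding tens_def by blast
    then have "r \<in> (\<lambda>(i, j, \<mu>). Nd a b i j \<mu>) ` (X a \<times> Y b \<times> {..<Nfus C a b c})"
      by (intro image_eqI[of _ _ "(i, j, \<mu>)"]) simp_all
    then show "r \<in> (\<Union>a. \<Union>b. (\<lambda>(i, j, \<mu>). Nd a b i j \<mu>) ` (X a \<times> Y b \<times> {..<Nfus C a b c}))"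
      by blast
  qed
  moreover have "finite \<dots>"
    using assms by (auto simp: is_obj_def intro!: finite_cartesian_product)
  ultimately show "finite (tens C X Y c)"
    by (rule finite_subset)
qed

lemma Nd_in_tens [simp]:
  "Nd a b i j \<mu> \<in> tens C X Y c \<longleftrightarrow> i \<in> X a \<and> j \<in> Y b \<and> \<mu> < Nfus C a b c"
  by (simp add: tens_def)

text \<open>\<open>Sum_any\<close> defaults to 0 on infinite support. A morphism into the finite
  object \<open>Y\<close> has its support in \<open>Y a\<close>, so that composition becomes a
  finite matrix product.\<close>

lemma comp_apply_right:
  assumes "f \<in> hom X Y" "is_obj Y"
  shows "(g \<odot> f) a i k = (\<Sum>j\<in>Y a. g a i j * f a j k)"
  unfolding comp_def using assms
  by (intro Sum_any.expand_superset) (auto simp: hom_def is_obj_def)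

lemma comp_apply_left:
  assumes "g \<in> hom Y Z" "is_obj Y"
  shows "(g \<odot> f) a i k = (\<Sum>j\<in>Y a. g a i j * f a j k)"
  unfolding comp_def using assms
  by (intro Sum_any.expand_superset) (auto simp: hom_def is_obj_def)

text \<open>Typing the two outer factors bounds both summation indices by finite sets, after which
  the double sum can be interchanged.\<close>

lemma comp_assoc_hom:
  assumes "f \<in> hom W X" "h \<in> hom Y Z" "is_obj X" "is_obj Y"
  shows "(h \<odot> g) \<odot> f = h \<odot> (g \<odot> f)"
proof (intro ext)
  fix a i k
  have "((h \<odot> g) \<odot> f) a i k = (\<Sum>j\<in>X a. \<Sum>l\<in>Y a. h a i l * g a l j * f a j k)"
    by (simp add: comp_apply_right[OF assms(1,3)] comp_apply_left[OF assms(2,4)] sum_distrib_right)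
  also have "\<dots> = (\<Sum>l\<in>Y a. \<Sum>j\<in>X a. h a i l * g a l j * f a j k)"
    by (rule sum.swap)
  also have "\<dots> = (h \<odot> (g \<odot> f)) a i k"
    by (simp add: comp_apply_right[OF assms(1,3)] comp_apply_left[OF assms(2,4)] sum_distrib_left
        mult.assoc)
  finally show "((h \<odot> g) \<odot> f) a i k = (h \<odot> (g \<odot> f)) a i k" .
qed

lemma comp_idm_right:
  assumes "f \<in> hom X Y" "is_obj X"
  shows "f \<odot> idm X = f"
proof (intro ext)
  fix a i k
  have "(f \<odot> idm X) a i k = (\<Sum>j\<in>X a. if j = k then f a i j else 0)"
    unfolding comp_apply_left[OF assms] by (rule sum.cong) (auto simp: idm_def)
  then show "(f \<odot> idm X) a i k = f a i k"
    using assms by (auto simp: hom_def is_obj_def)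
qed

lemma comp_idm_left:
  assumes "f \<in> hom X Y" "is_obj Y"
  shows "idm Y \<odot> f = f"
proof (intro ext)
  fix a i k
  have "(idm Y \<odot> f) a i k = (\<Sum>j\<in>Y a. if i = j then f a j k else 0)"
    unfolding comp_apply_right[OF assms] by (rule sum.cong) (auto simp: idm_def)
  then show "(idm Y \<odot> f) a i k = f a i k"
    using assms by (auto simp: hom_def is_obj_def)
qed

lemma inverse_mor_unique:
  assumes "is_obj X" "is_obj Y" "f \<in> hom X Y" "g \<in> hom Y X" "h \<in> hom Y X"
    and "g \<odot> f = idm X" "f \<odot> h = idm Y"
  shows "g = h"
proof -
  have "g = g \<odot> (f \<odot> h)"
    using assms by (simp add: comp_idm_right)
  also have "\<dots> = (g \<odot> f) \<odot> h"
    using assms by (subst comp_assoc_hom[of h Y X g Y X]) simp_all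
  also have "\<dots> = h"
    using assms by (simp add: comp_idm_left)
  finally show ?thesis .
qed

text \<open>Resolves the definite description in \<open>inv_mor\<close>: a two-sided inverse is
  unique by \<open>g = g f h = h\<close>, so exhibiting one determines the value.\<close>

lemma inv_mor_eqI:
  assumes "is_obj X" "is_obj Y" "f \<in> hom X Y" "g \<in> hom Y X" "g \<odot> f = idm X" "f \<odot> g = idm Y"
  shows "inv_mor X Y f = g"
  unfolding inv_mor_def
  by (rule the_equality) (use assms inverse_mor_unique[OF assms(1-3)] in blast)+

section \<open>Fusion trees and the associator in blocks\<close>

text \<open>Separates the copies \<open>i\<close>, \<open>j\<close>, \<open>k\<close> of the three
  anyons from the fusion tree. In these coordinates, and those of \<open>ridx\<close>, the
  associator is block diagonal in the copies, each block being an F matrix.\<close>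

definition lidx :: "'a \<Rightarrow> 'a \<Rightarrow> 'a \<Rightarrow> 'a idx \<Rightarrow> 'a idx \<Rightarrow> 'a idx \<Rightarrow> 'a \<times> nat \<times> nat \<Rightarrow> 'a idx" where
  "lidx a b c i j k = (\<lambda>(e, \<alpha>, \<beta>). Nd e c (Nd a b i j \<alpha>) k \<beta>)"

definition ridx :: "'a \<Rightarrow> 'a \<Rightarrow> 'a \<Rightarrow> 'a idx \<Rightarrow> 'a idx \<Rightarrow> 'a idx \<Rightarrow> 'a \<times> nat \<times> nat \<Rightarrow> 'a idx" where
  "ridx a b c i j k = (\<lambda>(f, \<mu>, \<nu>). Nd a f i (Nd b c j k \<mu>) \<nu>)"

lemma lidx_eq_iff [simp]:
  "lidx a b c i j k s = lidx a' b' c' i' j' k' s' \<longleftrightarrow>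
     a = a' \<and> b = b' \<and> c = c' \<and> i = i' \<and> j = j' \<and> k = k' \<and> s = s'"
  by (cases s; cases s') (auto simp: lidx_def)

lemma ridx_eq_iff [simp]:
  "ridx a b c i j k s = ridx a' b' c' i' j' k' s' \<longleftrightarrow>
     a = a' \<and> b = b' \<and> c = c' \<and> i = i' \<and> j = j' \<and> k = k' \<and> s = s'"
  by (cases s; cases s') (auto simp: ridx_def)

lemma lidx_in_tens [simp]:
  "lidx a b c i j k s \<in> tens C (tens C X Y) Z d \<longleftrightarrow>
     i \<in> X a \<and> j \<in> Y b \<and> k \<in> Z c \<and> s \<in> ltrees C a b c d"
  by (cases s) (auto simp: lidx_def ltrees_def)

lemma ridx_in_tens [simp]:
  "ridx a b c i j k s \<in> tens C X (tens C Y Z) d \<longleftrightarrow>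
     i \<in> X a \<and> j \<in> Y b \<and> k \<in> Z c \<and> s \<in> rtrees C a b c d"
  by (cases s) (auto simp: ridx_def rtrees_def)

lemma in_tens_lidxE:
  assumes "r \<in> tens C (tens C X Y) Z d"
  obtains a b c i j k s where "r = lidx a b c i j k s" "i \<in> X a" "j \<in> Y b" "k \<in> Z c"
    "s \<in> ltrees C a b c d"
proof -
  obtain e c t k \<beta> where r: "r = Nd e c t k \<beta>" "t \<in> tens C X Y e" "k \<in> Z c" "\<beta> < Nfus C e c d"
    using assms unfolding tens_def[of C "tens C X Y" Z] by blast
  then obtain a b i j \<alpha> where "t = Nd a b i j \<alpha>" "i \<in> X a" "j \<in> Y b" "\<alpha> < Nfus C a b e"
    unfolding tens_def by blast
  with r that[of a b c i j k "(e, \<alpha>, \<beta>)"] show thesis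
    by (simp add: lidx_def ltrees_def)
qed

lemma in_tens_ridxE:
  assumes "r \<in> tens C X (tens C Y Z) d"
  obtains a b c i j k s where "r = ridx a b c i j k s" "i \<in> X a" "j \<in> Y b" "k \<in> Z c"
    "s \<in> rtrees C a b c d"
proof -
  obtain a f i t \<nu> where r: "r = Nd a f i t \<nu>" "i \<in> X a" "t \<in> tens C Y Z f" "\<nu> < Nfus C a f d"
    using assms unfolding tens_def[of C X "tens C Y Z"] by blast
  then obtain b c j k \<mu> where "t = Nd b c j k \<mu>" "j \<in> Y b" "k \<in> Z c" "\<mu> < Nfus C b c f"
    unfolding tens_def by blast
  with r that[of a b c i j k "(f, \<mu>, \<nu>)"] show thesis
    by (simp add: ridx_def rtrees_def)
qed

lemma finite_ltrees [simp]: "finite (ltrees (C :: 'a::finite mtc_data) a b c d)"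
proof -
  have "ltrees C a b c d \<subseteq> (\<Union>e. {e} \<times> {..<Nfus C a b e} \<times> {..<Nfus C e c d})"
    by (auto simp: ltrees_def)
  then show ?thesis
    by (rule finite_subset) auto
qed

lemma finite_rtrees [simp]: "finite (rtrees (C :: 'a::finite mtc_data) a b c d)"
proof -
  have "rtrees C a b c d \<subseteq> (\<Union>f. {f} \<times> {..<Nfus C b c f} \<times> {..<Nfus C a f d})"
    by (auto simp: rtrees_def)
  then show ?thesis
    by (rule finite_subset) auto
qed

lemma F_entry_idx:
  "F_entry C d (ridx a' b' c' i' j' k' t) (lidx a b c i j k s) =
     (if a' = a \<and> b' = b \<and> c' = c \<and> i' = i \<and> j' = j \<and> k' = k then Fsym C a b c d s t else 0)"
  by (cases s; cases t) (simp add: lidx_def ridx_def)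

lemma assoc_idx:
  "assoc C X Y Z d (ridx a' b' c' i' j' k' t) (lidx a b c i j k s) =
     (if a' = a \<and> b' = b \<and> c' = c \<and> i' = i \<and> j' = j \<and> k' = k \<and> i \<in> X a \<and> j \<in> Y b \<and> k \<in> Z c \<and>
         s \<in> ltrees C a b c d \<and> t \<in> rtrees C a b c d
      then Fsym C a b c d s t else 0)"
  by (auto simp: assoc_def F_entry_idx)

text \<open>Confines the nonzero entries of a row or column to one block, hence to finitely many
  trees. This turns the \<open>Sum_any\<close> in a composite with the associator into a sum over
  trees.\<close>

lemma assoc_nonzeroD:
  assumes "assoc C X Y Z d r s \<noteq> 0"
  obtains a b c i j k t u where "r = ridx a b c i j k t" "s = lidx a b c i j k u"
    "t \<in> rtrees C a b c d" "u \<in> ltrees C a b c d" "i \<in> X a" "j \<in> Y b" "k \<in> Z c"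
proof -
  have rs: "r \<in> tens C X (tens C Y Z) d" "s \<in> tens C (tens C X Y) Z d"
    using assms by (auto simp: assoc_def split: if_splits)
  obtain a b c i j k t where r: "r = ridx a b c i j k t"
    using rs(1) by (rule in_tens_ridxE)
  obtain a' b' c' i' j' k' u where s: "s = lidx a' b' c' i' j' k' u"
    using rs(2) by (rule in_tens_lidxE)
  have "a' = a \<and> b' = b \<and> c' = c \<and> i' = i \<and> j' = j \<and> k' = k"
    using assms by (auto simp: r s assoc_idx split: if_splits)
  with rs show thesis
    by (intro that[of a b c i j k t u]) (simp_all add: r s)
qed

lemma assoc_hom: "assoc C X Y Z \<in> hom (tens C (tens C X Y) Z) (tens C X (tens C Y Z))"
  by (auto simp: hom_def assoc_def)

lemma comp_assoc_lidx:
  fixes C :: "'a::finite mtc_data"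
  assumes "i \<in> X a" "j \<in> Y b" "k \<in> Z c" "s \<in> ltrees C a b c d"
  shows "(g \<odot> assoc C X Y Z) d x (lidx a b c i j k s) =
    (\<Sum>t\<in>rtrees C a b c d. g d x (ridx a b c i j k t) * Fsym C a b c d s t)"
proof -
  have "(g \<odot> assoc C X Y Z) d x (lidx a b c i j k s) =
      (\<Sum>r\<in>ridx a b c i j k ` rtrees C a b c d. g d x r * assoc C X Y Z d r (lidx a b c i j k s))"
    unfolding comp_def
    by (rule Sum_any.expand_superset) (auto elim!: assoc_nonzeroD)
  then show ?thesis
    using assms by (simp add: sum.reindex inj_on_def assoc_idx)
qed

lemma comp_assoc_ridx:
  fixes C :: "'a::finite mtc_data"
  assumes "i \<in> X a" "j \<in> Y b" "k \<in> Z c" "t \<in> rtrees C a b c d"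
  shows "(assoc C X Y Z \<odot> g) d (ridx a b c i j k t) x =
    (\<Sum>s\<in>ltrees C a b c d. Fsym C a b c d s t * g d (lidx a b c i j k s) x)"
proof -
  have "(assoc C X Y Z \<odot> g) d (ridx a b c i j k t) x =
      (\<Sum>s\<in>lidx a b c i j k ` ltrees C a b c d. assoc C X Y Z d (ridx a b c i j k t) s * g d s x)"
    unfolding comp_def
    by (rule Sum_any.expand_superset) (auto elim!: assoc_nonzeroD)
  then show ?thesis
    using assms by (simp add: sum.reindex inj_on_def assoc_idx)
qed

section \<open>Inverting the associator on arbitrary objects\<close>

text \<open>A simple object has the single copy \<open>Pt 0\<close>, so the associator on three
  simple objects is the F matrix itself, and the entries of its inverse give \<open>G\<close>. As a
  linear map F sends left trees to right trees, so \<open>s\<close> is the column index and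
  \<open>t\<close> the row index of \<open>Fsym\<close>.\<close>

lemma Fsym_invertible:
  fixes C :: "'a::finite mtc_data"
  assumes "iso_mor (tens C (tens C (simp_obj a) (simp_obj b)) (simp_obj c))
      (tens C (simp_obj a) (tens C (simp_obj b) (simp_obj c)))
      (assoc C (simp_obj a) (simp_obj b) (simp_obj c))"
  obtains G where
    "\<And>d s s'. s \<in> ltrees C a b c d \<Longrightarrow> s' \<in> ltrees C a b c d \<Longrightarrow>
       (\<Sum>t\<in>rtrees C a b c d. G d s' t * Fsym C a b c d s t) = of_bool (s' = s)"
    "\<And>d t t'. t \<in> rtrees C a b c d \<Longrightarrow> t' \<in> rtrees C a b c d \<Longrightarrow>
       (\<Sum>s\<in>ltrees C a b c d. Fsym C a b c d s t' * G d s t) = of_bool (t' = t)"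
proof -
  let ?X = "simp_obj a" and ?Y = "simp_obj b" and ?Z = "simp_obj c"
  let ?l = "lidx a b c (Pt 0) (Pt 0) (Pt 0)" and ?r = "ridx a b c (Pt 0) (Pt 0) (Pt 0)"
  obtain g where g: "g \<odot> assoc C ?X ?Y ?Z = idm (tens C (tens C ?X ?Y) ?Z)"
    "assoc C ?X ?Y ?Z \<odot> g = idm (tens C ?X (tens C ?Y ?Z))"
    using assms unfolding iso_mor_def by blast
  have pt [simp]: "Pt 0 \<in> simp_obj x x" for x :: 'a
    by (simp add: simp_obj_def)
  show thesis
  proof (rule that[of "\<lambda>d s t. g d (?l s) (?r t)"])
    fix d s s' assume "s \<in> ltrees C a b c d" "s' \<in> ltrees C a b c d"
    then show "(\<Sum>t\<in>rtrees C a b c d. g d (?l s') (?r t) * Fsym C a b c d s t) = of_bool (s' = s)"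
      by (subst comp_assoc_lidx[of _ ?X _ _ ?Y _ _ ?Z, symmetric])
        (simp_all add: g idm_def)
  next
    fix d t t' assume "t \<in> rtrees C a b c d" "t' \<in> rtrees C a b c d"
    then show "(\<Sum>s\<in>ltrees C a b c d. Fsym C a b c d s t' * g d (?l s) (?r t)) = of_bool (t' = t)"
      by (subst comp_assoc_ridx[of _ ?X _ _ ?Y _ _ ?Z, symmetric])
        (simp_all add: g idm_def)
  qed
qed

text \<open>The counterpart of \<open>F_entry\<close> with source and target exchanged, for a
  candidate \<open>G\<close> for the inverse F matrices.\<close>

fun assoc_inv_entry ::
  "('a \<Rightarrow> 'a \<Rightarrow> 'a \<Rightarrow> 'a \<Rightarrow> 'a \<times> nat \<times> nat \<Rightarrow> 'a \<times> nat \<times> nat \<Rightarrow> complex) \<Rightarrow> 'a mor" where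
  "assoc_inv_entry G d (Nd e c (Nd a b i j \<alpha>) k \<beta>) (Nd a' f i' (Nd b' c' j' k' \<mu>) \<nu>) =
     (if a' = a \<and> b' = b \<and> c' = c \<and> i' = i \<and> j' = j \<and> k' = k
      then G a b c d (e, \<alpha>, \<beta>) (f, \<mu>, \<nu>) else 0)"
| "assoc_inv_entry G d _ _ = 0"

lemma assoc_inv_entry_idx:
  "assoc_inv_entry G d (lidx a b c i j k s) (ridx a' b' c' i' j' k' t) =
     (if a' = a \<and> b' = b \<and> c' = c \<and> i' = i \<and> j' = j \<and> k' = k then G a b c d s t else 0)"
  by (cases s; cases t) (simp add: lidx_def ridx_def)

text \<open>Each block of the associator on \<open>X\<close>, \<open>Y\<close>, \<open>Z\<close>
  repeats the F matrix of a triple of anyons, so inverting block by block yields an inverse.\<close>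

lemma iso_mor_assoc:
  fixes C :: "'a::finite mtc_data"
  assumes simple: "\<And>a b c. iso_mor (tens C (tens C (simp_obj a) (simp_obj b)) (simp_obj c))
      (tens C (simp_obj a) (tens C (simp_obj b) (simp_obj c)))
      (assoc C (simp_obj a) (simp_obj b) (simp_obj c))"
  shows "iso_mor (tens C (tens C X Y) Z) (tens C X (tens C Y Z)) (assoc C X Y Z)"
proof -
  let ?L = "tens C (tens C X Y) Z" and ?R = "tens C X (tens C Y Z)"
  \<comment> \<open>Both inverse laws form one predicate of the triple, so that a single choice
    provides inverses for all triples of anyons.\<close>
  define inverse_F where "inverse_F a b c H \<longleftrightarrow> (\<forall>d.
      (\<forall>s\<in>ltrees C a b c d. \<forall>s'\<in>ltrees C a b c d.
         (\<Sum>t\<in>rtrees C a b c d. H d s' t * Fsym C a b c d s t) = of_bool (s' = s)) \<and>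
      (\<forall>t\<in>rtrees C a b c d. \<forall>t'\<in>rtrees C a b c d.
         (\<Sum>s\<in>ltrees C a b c d. Fsym C a b c d s t' * H d s t) = of_bool (t' = t)))" for a b c H
  have "\<exists>H. inverse_F a b c H" for a b c
    unfolding inverse_F_def by (rule Fsym_invertible[OF simple, of a b c]) blast
  then obtain G where "\<And>a b c. inverse_F a b c (G a b c)"
    by metis
  then have
    G: "\<And>a b c d s s'. s \<in> ltrees C a b c d \<Longrightarrow> s' \<in> ltrees C a b c d \<Longrightarrow>
         (\<Sum>t\<in>rtrees C a b c d. G a b c d s' t * Fsym C a b c d s t) = of_bool (s' = s)"
      "\<And>a b c d t t'. t \<in> rtrees C a b c d \<Longrightarrow> t' \<in> rtrees C a b c d \<Longrightarrow>
         (\<Sum>s\<in>ltrees C a b c d. Fsym C a b c d s t' * G a b c d s t) = of_bool (t' = t)"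
    unfolding inverse_F_def by blast+
  \<comment> \<open>The cut-off to the index sets makes \<open>g\<close> a morphism from
    \<open>?R\<close> to \<open>?L\<close>.\<close>
  define g where "g d s r = (if s \<in> ?L d \<and> r \<in> ?R d then assoc_inv_entry G d s r else 0)" for d s r
  have g_idx: "g d (lidx a b c i j k s) (ridx a' b' c' i' j' k' t) =
     (if a' = a \<and> b' = b \<and> c' = c \<and> i' = i \<and> j' = j \<and> k' = k \<and> i \<in> X a \<and> j \<in> Y b \<and> k \<in> Z c \<and>
         s \<in> ltrees C a b c d \<and> t \<in> rtrees C a b c d
      then G a b c d s t else 0)" for d a b c i j k s a' b' c' i' j' k' t
    by (auto simp: g_def assoc_inv_entry_idx)
  have hom: "g \<in> hom ?R ?L"
    by (auto simp: hom_def g_def split: if_splits)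
  have "(g \<odot> assoc C X Y Z) d s s' = idm ?L d s s'" for d s s'
  proof (cases "s \<in> ?L d \<and> s' \<in> ?L d")
    case True
    then have in_tens: "s \<in> ?L d" "s' \<in> ?L d"
      by simp_all
    obtain a b c i j k t where
      s: "s = lidx a b c i j k t" "i \<in> X a" "j \<in> Y b" "k \<in> Z c" "t \<in> ltrees C a b c d"
      using in_tens(1) by (rule in_tens_lidxE)
    obtain a' b' c' i' j' k' t' where
      s': "s' = lidx a' b' c' i' j' k' t'" "i' \<in> X a'" "j' \<in> Y b'" "k' \<in> Z c'"
        "t' \<in> ltrees C a' b' c' d"
      using in_tens(2) by (rule in_tens_lidxE)
    show ?thesis
    proof (cases "a' = a \<and> b' = b \<and> c' = c \<and> i' = i \<and> j' = j \<and> k' = k")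
      case True
      with s s' show ?thesis
        by (simp add: comp_assoc_lidx g_idx G idm_def)
    \<comment> \<open>Between different blocks every summand vanishes, as does the entry of the
      identity.\<close>
    next
      case False
      with s s' show ?thesis
        by (auto simp: comp_assoc_lidx g_idx idm_def intro!: sum.neutral)
    qed
  next
    case False
    \<comment> \<open>An index outside \<open>?L d\<close> annihilates one of the two factors,
      whatever the middle index is.\<close>
    then have zero: "g d s r * assoc C X Y Z d r s' = 0" for r
      by (auto simp: g_def assoc_def)
    show ?thesis
      unfolding comp_def zero using False by (auto simp: idm_def)
  qed
  moreover have "(assoc C X Y Z \<odot> g) d r r' = idm ?R d r r'" for d r r'
  proof (cases "r \<in> ?R d \<and> r' \<in> ?R d")
    case True
    then have in_tens: "r \<in> ?R d" "r' \<in> ?R d"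
      by simp_all
    obtain a b c i j k t where
      r: "r = ridx a b c i j k t" "i \<in> X a" "j \<in> Y b" "k \<in> Z c" "t \<in> rtrees C a b c d"
      using in_tens(1) by (rule in_tens_ridxE)
    obtain a' b' c' i' j' k' t' where
      r': "r' = ridx a' b' c' i' j' k' t'" "i' \<in> X a'" "j' \<in> Y b'" "k' \<in> Z c'"
        "t' \<in> rtrees C a' b' c' d"
      using in_tens(2) by (rule in_tens_ridxE)
    show ?thesis
    proof (cases "a' = a \<and> b' = b \<and> c' = c \<and> i' = i \<and> j' = j \<and> k' = k")
      case True
      with r r' show ?thesis
        by (simp add: comp_assoc_ridx g_idx G idm_def)
    next
      case False
      with r r' show ?thesis
        by (auto simp: comp_assoc_ridx g_idx idm_def intro!: sum.neutral)
    qed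
  next
    case False
    then have zero: "assoc C X Y Z d r s * g d s r' = 0" for s
      by (auto simp: g_def assoc_def)
    show ?thesis
      unfolding comp_def zero using False by (auto simp: idm_def)
  qed
  ultimately show ?thesis
    unfolding iso_mor_def using assoc_hom[of C X Y Z] hom by (blast intro: ext)
qed


section \<open>Transport along an automorphism of the complex numbers\<close>

locale complex_automorphism =
  fixes \<sigma> :: "complex \<Rightarrow> complex"
  assumes aut: "\<sigma> \<in> Gal UNIV"
begin

lemma bij: "bij \<sigma>" and add [simp]: "\<sigma> (x + y) = \<sigma> x + \<sigma> y" and mult [simp]: "\<sigma> (x * y) = \<sigma> x * \<sigma> y"
  and of_rat [simp]: "\<sigma> (of_rat r) = of_rat r"
  using aut by (auto simp: Gal_def)

lemma eq_iff [simp]: "\<sigma> x = \<sigma> y \<longleftrightarrow> x = y"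
  using bij by (simp add: bij_def inj_eq)

text \<open>Special cases of fixing the rationals. The value at -1 serves the pivotal coefficients,
  which are signs.\<close>

lemma zero [simp]: "\<sigma> 0 = 0" and one [simp]: "\<sigma> 1 = 1" and minus_one [simp]: "\<sigma> (- 1) = - 1"
  using of_rat[of 0] of_rat[of 1] of_rat[of "- 1"] by (simp_all del: of_rat)

lemma eq_0_iff [simp]: "\<sigma> x = 0 \<longleftrightarrow> x = 0"
  by (metis eq_iff zero)

lemma of_nat [simp]: "\<sigma> (of_nat n) = of_nat n"
  by (induction n) simp_all

lemma power [simp]: "\<sigma> (x ^ n) = \<sigma> x ^ n"
  by (induction n) simp_all

lemma divide [simp]: "\<sigma> (x / y) = \<sigma> x / \<sigma> y"
proof (cases "y = 0")
  case False
  then have "\<sigma> (x / y) * \<sigma> y = \<sigma> x"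
    by (simp flip: mult)
  with False show ?thesis
    by (simp add: field_simps)
qed simp

lemma sum: "\<sigma> (\<Sum>x\<in>S. f x) = (\<Sum>x\<in>S. \<sigma> (f x))"
  by (induction S rule: infinite_finite_induct) simp_all

text \<open>Since \<open>\<sigma>\<close> vanishes only at 0, both families have the same support;
  either both sides are the same finite sum, or both take the default 0.\<close>

lemma Sum_any: "\<sigma> (Sum_any f) = Sum_any (\<lambda>x. \<sigma> (f x))"
  by (simp add: Sum_any.expand_set sum)

definition conj_mor :: "'a mor \<Rightarrow> 'a mor" where
  "conj_mor f = (\<lambda>a i j. \<sigma> (f a i j))"

text \<open>The carrier is kept because objects are index sets, and \<open>\<sigma>\<close> moves
  matrix entries only.\<close>

definition conj_mod :: "'a amod \<Rightarrow> 'a amod" where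
  "conj_mod M = \<lparr>mcarr = mcarr M, act = conj_mor (act M)\<rparr>"

lemma conj_mor_eq_iff [simp]: "conj_mor f = conj_mor g \<longleftrightarrow> f = g"
  by (simp add: conj_mor_def fun_eq_iff)

lemma surj_conj_mor: "surj conj_mor"
proof (rule surjI)
  show "conj_mor (\<lambda>a i j. inv \<sigma> (f a i j)) = f" for f :: "'a mor"
    using bij by (simp add: conj_mor_def bij_is_surj surj_f_inv_f)
qed

lemma mcarr_conj_mod [simp]: "mcarr (conj_mod M) = mcarr M"
  and act_conj_mod [simp]: "act (conj_mod M) = conj_mor (act M)"
  by (simp_all add: conj_mod_def)

lemma inj_conj_mod: "inj conj_mod"
  by (auto simp: inj_def conj_mod_def)

lemma surj_conj_mod: "surj conj_mod"
  unfolding surj_def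
proof
  fix N :: "'a amod"
  obtain f where "act N = conj_mor f"
    using surj_conj_mor by (meson surjD)
  then show "\<exists>M. N = conj_mod M"
    by (intro exI[of _ "\<lparr>mcarr = mcarr N, act = f\<rparr>"]) (simp add: conj_mod_def)
qed

section \<open>Re-indexing quantifiers along the conjugation\<close>

text \<open>Conjugation is a bijection on morphisms, so a quantifier over all of them may range over
  conjugates instead. This reduces the transfer of a quantified notion to that of its body.\<close>

lemma all_mor_cong: "(\<And>f. Q (conj_mor f) \<longleftrightarrow> P f) \<Longrightarrow> (\<forall>f. Q f) \<longleftrightarrow> (\<forall>f. P f)"
  and ex_mor_cong: "(\<And>f. Q (conj_mor f) \<longleftrightarrow> P f) \<Longrightarrow> (\<exists>f. Q f) \<longleftrightarrow> (\<exists>f. P f)"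
  and ex1_mor_cong: "(\<And>f. Q (conj_mor f) \<longleftrightarrow> P f) \<Longrightarrow> (\<exists>!f. Q f) \<longleftrightarrow> (\<exists>!f. P f)"
  by (metis surj_conj_mor surjD conj_mor_eq_iff)+

lemma all_mod_cong: "(\<And>M. Q (conj_mod M) \<longleftrightarrow> P M) \<Longrightarrow> (\<forall>M. Q M) \<longleftrightarrow> (\<forall>M. P M)"
  and ex_mod_cong: "(\<And>M. Q (conj_mod M) \<longleftrightarrow> P M) \<Longrightarrow> (\<exists>M. Q M) \<longleftrightarrow> (\<exists>M. P M)"
  by (metis surj_conj_mod surjD)+

lemma bex_mod_cong:
  "(\<And>M. Q (conj_mod M) \<longleftrightarrow> P M) \<Longrightarrow> (\<exists>M\<in>conj_mod ` S. Q M) \<longleftrightarrow> (\<exists>M\<in>S. P M)"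
  by simp

text \<open>For the lists of summands in a decomposition; a preimage is taken entry by
  entry.\<close>

lemma ex_mods_cong:
  assumes "\<And>Ms. Q (map conj_mod Ms) \<longleftrightarrow> P Ms"
  shows "(\<exists>Ms. Q Ms) \<longleftrightarrow> (\<exists>Ms. P Ms)"
proof
  assume "\<exists>Ms. Q Ms"
  then obtain Ms where "Q Ms" ..
  moreover have "map conj_mod (map (inv conj_mod) Ms) = Ms"
    by (simp add: surj_conj_mod surj_iff[THEN iffD1])
  ultimately show "\<exists>Ms. P Ms"
    by (intro exI[of _ "map (inv conj_mod) Ms"]) (simp flip: assms)
qed (use assms in blast)

text \<open>For the families of inclusions and projections of a direct sum.\<close>

lemma ex_mor_family_cong:
  assumes "\<And>\<iota>. Q (\<lambda>k. conj_mor (\<iota> k)) \<longleftrightarrow> P \<iota>"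
  shows "(\<exists>\<iota>. Q \<iota>) \<longleftrightarrow> (\<exists>\<iota>. P \<iota>)"
proof
  assume "\<exists>\<iota>. Q \<iota>"
  then obtain \<iota> where "Q \<iota>" ..
  then show "\<exists>\<iota>. P \<iota>"
    by (intro exI[of _ "\<lambda>k. inv conj_mor (\<iota> k)"])
      (simp add: surj_conj_mor surj_f_inv_f flip: assms)
qed (use assms in blast)

lemma conj_mor_hom [simp]: "conj_mor f \<in> hom X Y \<longleftrightarrow> f \<in> hom X Y"
  by (simp add: hom_def conj_mor_def)

lemma conj_mor_idm: "conj_mor (idm X) = idm X"
  by (simp add: conj_mor_def idm_def fun_eq_iff)

lemma conj_mor_zerom: "conj_mor zerom = zerom"
  by (simp add: conj_mor_def zerom_def)

lemma conj_mor_eq_idm [simp]: "conj_mor f = idm X \<longleftrightarrow> f = idm X"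
  by (metis conj_mor_idm conj_mor_eq_iff)

lemma conj_mor_eq_zerom [simp]: "conj_mor f = zerom \<longleftrightarrow> f = zerom"
  by (metis conj_mor_zerom conj_mor_eq_iff)

text \<open>Functoriality, oriented to pull \<open>conj_mor\<close> outwards. Equations between
  conjugated composites then reduce to the original ones by \<open>conj_mor_eq_iff\<close>.\<close>

lemma comp_conj_mor [simp]: "conj_mor g \<odot> conj_mor f = conj_mor (g \<odot> f)"
  by (simp add: conj_mor_def comp_def Sum_any)

end

section \<open>Conjugating the modular data\<close>

text \<open>\<open>D\<close> plays the role of q(C). The symbols are compared within the fusion
  ranges only, because entries outside them may lie off the defining field, where
  \<open>\<sigma>\<close> and \<open>q\<close> may differ.\<close>

locale conjugate_data = complex_automorphism \<sigma> for \<sigma> +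
  fixes C D :: "'a::finite mtc_data"
  assumes mtc: "mtc C"
    and vac [simp]: "vac D = vac C"
    and Nfus [simp]: "Nfus D = Nfus C"
    and piv [simp]: "piv D = piv C"
    and Fsym: "s \<in> ltrees C a b c d \<Longrightarrow> t \<in> rtrees C a b c d \<Longrightarrow>
      Fsym D a b c d s t = \<sigma> (Fsym C a b c d s t)"
    and Rsym: "\<mu> < Nfus C a b c \<Longrightarrow> \<nu> < Nfus C b a c \<Longrightarrow> Rsym D a b c \<mu> \<nu> = \<sigma> (Rsym C a b c \<mu> \<nu>)"
begin

lemma tens_conj [simp]: "tens D = tens C"
  by (simp add: tens_def fun_eq_iff)

lemma tensm_conj [simp]: "tensm D (conj_mor f) (conj_mor g) = conj_mor (tensm C f g)"
proof -
  have "tensm D (conj_mor f) (conj_mor g) c r s = conj_mor (tensm C f g) c r s" for c r s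
    by (cases r; cases s) (simp_all add: conj_mor_def)
  then show ?thesis
    by (intro ext)
qed

text \<open>The mixed cases are stated separately because simplification leaves \<open>idm X\<close>
  as it is instead of presenting it as a conjugate.\<close>

lemma tensm_conj_idm [simp]:
  "tensm D (conj_mor f) (idm X) = conj_mor (tensm C f (idm X))"
  "tensm D (idm X) (conj_mor f) = conj_mor (tensm C (idm X) f)"
  by (metis tensm_conj conj_mor_idm)+

lemma lunit_conj [simp]: "lunit D X = conj_mor (lunit C X)"
  by (simp add: lunit_def conj_mor_def fun_eq_iff)

lemma runit_conj [simp]: "runit D X = conj_mor (runit C X)"
  by (simp add: runit_def conj_mor_def fun_eq_iff)

text \<open>Off the index sets both sides are 0 by the cut-off in \<open>assoc\<close>; on them the
  trees are admissible, so \<open>Fsym\<close> applies.\<close>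

lemma assoc_conj [simp]: "assoc D X Y Z = conj_mor (assoc C X Y Z)"
proof -
  have "assoc D X Y Z d r s = \<sigma> (assoc C X Y Z d r s)" for d r s
  proof (cases "r \<in> tens C X (tens C Y Z) d \<and> s \<in> tens C (tens C X Y) Z d")
    case True
    then have in_tens: "r \<in> tens C X (tens C Y Z) d" "s \<in> tens C (tens C X Y) Z d"
      by simp_all
    obtain a b c i j k t where
      "r = ridx a b c i j k t" "i \<in> X a" "j \<in> Y b" "k \<in> Z c" "t \<in> rtrees C a b c d"
      using in_tens(1) by (rule in_tens_ridxE)
    moreover obtain a' b' c' i' j' k' u where
      "s = lidx a' b' c' i' j' k' u" "i' \<in> X a'" "j' \<in> Y b'" "k' \<in> Z c'" "u \<in> ltrees C a' b' c' d"
      using in_tens(2) by (rule in_tens_lidxE)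
    ultimately show ?thesis
      by (auto simp: assoc_def F_entry_idx Fsym)
  qed (auto simp: assoc_def)
  then show ?thesis
    by (simp add: conj_mor_def fun_eq_iff)
qed

lemma braid_conj [simp]: "braid D X Y = conj_mor (braid C X Y)"
proof -
  have "braid D X Y c r s = \<sigma> (braid C X Y c r s)" for c r s
    by (auto simp: braid_def tens_def Rsym)
  then show ?thesis
    by (simp add: conj_mor_def fun_eq_iff)
qed

text \<open>The conjugate of an inverse is inverse to the conjugate. Its existence comes from
  \<open>iso_mor_assoc\<close>, and finiteness of the objects gives the uniqueness that
  \<open>inv_mor\<close> relies on.\<close>

lemma assoc_inv_conj:
  assumes "is_obj X" "is_obj Y" "is_obj Z"
  shows "assoc_inv D X Y Z = conj_mor (assoc_inv C X Y Z)"
proof -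
  let ?L = "tens C (tens C X Y) Z" and ?R = "tens C X (tens C Y Z)"
  have obj: "is_obj ?L" "is_obj ?R"
    using assms by (simp_all add: is_obj_tens)
  have "monoidal_axioms C"
    using mtc unfolding mtc_def by blast
  then have "iso_mor (tens C (tens C (simp_obj a) (simp_obj b)) (simp_obj c))
      (tens C (simp_obj a) (tens C (simp_obj b) (simp_obj c)))
      (assoc C (simp_obj a) (simp_obj b) (simp_obj c))" for a b c
    unfolding monoidal_axioms_def Let_def by blast
  then have "iso_mor ?L ?R (assoc C X Y Z)"
    by (rule iso_mor_assoc)
  then obtain g where g: "g \<in> hom ?R ?L" "g \<odot> assoc C X Y Z = idm ?L" "assoc C X Y Z \<odot> g = idm ?R"
    unfolding iso_mor_def by blast
  have "assoc_inv C X Y Z = g"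
    using inv_mor_eqI[OF obj assoc_hom g] .
  moreover have "assoc_inv D X Y Z = conj_mor g"
    using g assoc_hom[of C X Y Z] obj by (simp add: inv_mor_eqI)
  ultimately show ?thesis
    by simp
qed

lemma dual_conj: "dual D = dual C"
  by (simp add: dual_def fun_eq_iff)

lemma qdim_conj: "qdim D a = \<sigma> (qdim C a)"
proof -
  have fusion: "fusion_axioms C" and sph: "spherical_axioms C"
    using mtc by (simp_all add: mtc_def)
  obtain b where b: "\<And>c. Nfus C a c (vac C) = of_bool (c = b) \<and> Nfus C c a (vac C) = of_bool (c = b)"
    using fusion unfolding fusion_axioms_def by metis
  have "dual C a = b"
    using b by (auto simp: dual_def)
  \<comment> \<open>Fusion with the vacuum and the pairing of \<open>a\<close> with its dual have
    multiplicity one, so the vacuum labels are admissible trees.\<close>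
  then have "Fsym D a (dual C a) a a (vac C, 0, 0) (vac C, 0, 0) =
      \<sigma> (Fsym C a (dual C a) a a (vac C, 0, 0) (vac C, 0, 0))"
    using b fusion by (intro Fsym) (auto simp: ltrees_def rtrees_def fusion_axioms_def)
  moreover have "\<sigma> (piv C a) = piv C a"
  proof -
    have "piv C a \<in> {1, - 1}"
      using sph unfolding spherical_axioms_def by blast
    then show ?thesis
      by auto
  qed
  ultimately show ?thesis
    by (simp add: qdim_def dual_conj)
qed

end

section \<open>Conjugating algebras, modules and boundary excitations\<close>

locale conjugate_algebra = conjugate_data \<sigma> C D for \<sigma> and C D :: "'a::finite mtc_data" +
  fixes A B :: "'a alg"
  assumes carr [simp]: "carr B = carr A"
    and mult_alg [simp]: "mult B = conj_mor (mult A)"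
    and unt_alg [simp]: "unt B = conj_mor (unt A)"
begin

text \<open>The axioms transfer as equations between morphisms, and a separating section
  \<open>s\<close> becomes its conjugate. Both dimensions are moved by \<open>\<sigma>\<close>,
  which preserves the relation between them.\<close>

lemma lagrangian_algebra_conj:
  assumes "lagrangian_algebra C A"
  shows "lagrangian_algebra D B"
proof -
  have A: "algebra C A" "connected_alg C A" "commutative_alg C A" "separable_alg C A"
    "(obj_dim C (carr A))\<^sup>2 = global_dim C"
    using assms by (simp_all add: lagrangian_algebra_def)
  have "is_obj (carr A)"
    using A(1) by (simp add: algebra_def)
  then have "separable_alg D B \<longleftrightarrow> separable_alg C A"
    unfolding separable_alg_def Let_def Bex_def
    \<comment> \<open>Simplification rewrites \<open>tens D\<close> and \<open>assoc D\<close>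
      inside the inverse associator first; the rule is simplified likewise so that it still
      matches.\<close>
    by (intro ex_mor_cong conj_cong) (simp_all add: assoc_inv_conj[simplified])
  moreover have "algebra D B \<longleftrightarrow> algebra C A" "connected_alg D B \<longleftrightarrow> connected_alg C A"
    "commutative_alg D B \<longleftrightarrow> commutative_alg C A"
    by (simp_all add: algebra_def connected_alg_def commutative_alg_def)
  moreover have "obj_dim D (carr A) = \<sigma> (obj_dim C (carr A))" "global_dim D = \<sigma> (global_dim C)"
    by (simp_all add: obj_dim_def global_dim_def qdim_conj sum)
  then have "(obj_dim D (carr A))\<^sup>2 = global_dim D"
    using A(5) by (simp flip: power)
  ultimately show ?thesis
    using A by (simp add: lagrangian_algebra_def)
qed

lemma amodule_conj [simp]: "amodule D B (conj_mod M) \<longleftrightarrow> amodule C A M"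
  by (simp add: amodule_def)

lemma mod_hom_conj [simp]:
  "conj_mor f \<in> mod_hom D B (conj_mod M) (conj_mod N) \<longleftrightarrow> f \<in> mod_hom C A M N"
  by (simp add: mod_hom_def)

lemma mod_iso_conj [simp]:
  "mod_iso D B (conj_mod M) (conj_mod N) (conj_mor f) \<longleftrightarrow> mod_iso C A M N f"
  unfolding mod_iso_def Bex_def by (intro conj_cong ex_mor_cong) simp_all

lemma mod_mono_conj [simp]:
  "mod_mono D B (conj_mod M) (conj_mod N) (conj_mor f) \<longleftrightarrow> mod_mono C A M N f"
  unfolding mod_mono_def Ball_def
  by (intro conj_cong imp_cong all_mod_cong all_mor_cong) simp_all

lemma simple_module_conj [simp]: "simple_module D B (conj_mod M) \<longleftrightarrow> simple_module C A M"
  unfolding simple_module_def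
  by (intro conj_cong imp_cong all_mod_cong all_mor_cong) simp_all

lemma ex_mod_iso_conj:
  "(\<exists>f. mod_iso D B (conj_mod M) (conj_mod N) f) \<longleftrightarrow> (\<exists>f. mod_iso C A M N f)"
  by (intro ex_mor_cong) simp

text \<open>Every module over \<open>B\<close> is the conjugate of one over \<open>A\<close>, and
  every isomorphism between conjugates is itself a conjugate. Hence the class of
  \<open>conj_mod M\<close> is the image of the class of \<open>M\<close>.\<close>

lemma simple_excitations_conj:
  "simple_excitations D B = (`) conj_mod ` simple_excitations C A"
proof -
  define S where "S = {M. simple_module C A M}"
  define E where "E = {(M, N). simple_module C A M \<and> simple_module C A N \<and> (\<exists>f. mod_iso C A M N f)}"
  define E' where
    "E' = {(M, N). simple_module D B M \<and> simple_module D B N \<and> (\<exists>f. mod_iso D B M N f)}"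
  have S': "{M. simple_module D B M} = conj_mod ` S"
  proof -
    have "M \<in> {M. simple_module D B M} \<longleftrightarrow> M \<in> conj_mod ` S" for M
    proof -
      obtain L where L: "M = conj_mod L"
        using surj_conj_mod by (meson surjD)
      show ?thesis
        unfolding L by (simp add: S_def inj_image_mem_iff[OF inj_conj_mod])
    qed
    then show ?thesis
      by blast
  qed
  have E': "E' `` {conj_mod M} = conj_mod ` (E `` {M})" for M
  proof -
    have "N \<in> E' `` {conj_mod M} \<longleftrightarrow> N \<in> conj_mod ` (E `` {M})" for N
    proof -
      obtain L where L: "N = conj_mod L"
        using surj_conj_mod by (meson surjD)
      show ?thesis
        unfolding L by (simp add: E_def E'_def ex_mod_iso_conj inj_image_mem_iff[OF inj_conj_mod])
    qed
    then show ?thesis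
      by blast
  qed
  have "(conj_mod ` S) // E' = (`) conj_mod ` (S // E)"
    by (auto simp: quotient_def E')
  then show ?thesis
    unfolding simple_excitations_def S' S_def E_def E'_def .
qed

lemma tensor_over_conj [simp]:
  "tensor_over D B (conj_mod M) (conj_mod N) (conj_mod T) (conj_mor p) \<longleftrightarrow> tensor_over C A M N T p"
  unfolding tensor_over_def Let_def Ball_def
  \<comment> \<open>The test object \<open>Z\<close> of the universal property is left alone, hence
    \<open>all_cong1\<close> at the type of objects; only the quantifiers over \<open>h\<close> and
    \<open>k\<close> are re-indexed.\<close>
  by (intro arg_cong2[where f = "(\<and>)"] arg_cong2[where f = "(\<longrightarrow>)"] all_cong1[where 'a = "'a obj"]
      all_mor_cong ex1_mor_cong) simp_all

lemma direct_sum_of_conj [simp]: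
  "direct_sum_of D B (map conj_mod Ms) (conj_mod T) \<longleftrightarrow> direct_sum_of C A Ms T"
proof -
  have sum_eq: "(\<lambda>a i j. \<Sum>k < length Ms. conj_mor (h k) a i j) =
      conj_mor (\<lambda>a i j. \<Sum>k < length Ms. h k a i j)" for h :: "nat \<Rightarrow> 'a mor"
    by (simp add: conj_mor_def sum)
  have if_eq: "(conj_mor f = (if b then idm X else zerom)) \<longleftrightarrow> f = (if b then idm X else zerom)"
    for f :: "'a mor" and b X
    by simp
  show ?thesis
    unfolding direct_sum_of_def
    by (intro ex_mor_family_cong) (simp add: sum_eq if_eq)
qed

text \<open>The predicates under the two \<open>THE\<close> agree for every \<open>n\<close>: a
  decomposition is conjugated summand by summand, and injectivity of \<open>conj_mod\<close>
  preserves the number of summands in \<open>z\<close>.\<close>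

lemma boundary_fusion_conj:
  "boundary_fusion D B (conj_mod ` x) (conj_mod ` y) (conj_mod ` z) = boundary_fusion C A x y z"
proof -
  have count: "{k. k < length (map conj_mod Ms) \<and> map conj_mod Ms ! k \<in> conj_mod ` z} =
      {k. k < length Ms \<and> Ms ! k \<in> z}" for Ms
    by (rule Collect_cong) (simp add: inj_image_mem_iff[OF inj_conj_mod] cong: conj_cong)
  have simple: "(\<forall>L \<in> set (map conj_mod Ms). simple_module D B L) \<longleftrightarrow>
      (\<forall>L \<in> set Ms. simple_module C A L)" for Ms
    by simp
  show ?thesis
    unfolding boundary_fusion_def
    by (intro arg_cong[where f = The] ext bex_mod_cong ex_mod_cong ex_mor_cong ex_mods_cong)
      (simp only: count simple tensor_over_conj direct_sum_of_conj)
qed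

end

section \<open>Application to the Galois conjugate category\<close>

text \<open>Ensures that \<open>\<sigma>\<close>, an extension of \<open>q\<close> from the defining
  field, acts on the F and R entries as \<open>q\<close> does.\<close>

lemma FR_entries_subset_defining_field: "FR_entries C \<subseteq> defining_field C"
  unfolding defining_field_def FR_field_def by (meson hull_subset order_trans)

theorem theorem3p3:
  fixes C :: "'a::finite mtc_data" and q :: "complex \<Rightarrow> complex" and A B :: "'a alg"
  assumes "unitary_mtc C"
    and "number_field (FR_field C)"
    and "q \<in> Gal (defining_field C)"
    and "unitary_mtc (galois_conj q C)"
    and "lagrangian_algebra C A"
    and "galois_conj_alg q C A B"
  shows "lagrangian_algebra (galois_conj q C) B \<and>
    (\<exists>\<phi>. bij_betw \<phi> (simple_excitations C A) (simple_excitations (galois_conj q C) B) \<and>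
      (\<forall>x \<in> simple_excitations C A. \<forall>y \<in> simple_excitations C A. \<forall>z \<in> simple_excitations C A.
         boundary_fusion (galois_conj q C) B (\<phi> x) (\<phi> y) (\<phi> z) = boundary_fusion C A x y z))"
proof -
  obtain \<sigma> where \<sigma>: "\<sigma> \<in> Gal UNIV" "\<And>x. x \<in> defining_field C \<Longrightarrow> \<sigma> x = q x" "carr B = carr A"
    "mult B = (\<lambda>a i j. \<sigma> (mult A a i j))" "unt B = (\<lambda>a i j. \<sigma> (unt A a i j))"
    using assms(6) unfolding galois_conj_alg_def by blast
  have FR: "\<sigma> x = q x" if "x \<in> FR_entries C" for x
    using that FR_entries_subset_defining_field \<sigma>(2) by blast
  interpret complex_automorphism \<sigma>
    by unfold_locales (fact \<sigma>(1))
  interpret conjugate_data \<sigma> C "galois_conj q C"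
  proof unfold_locales
    show "mtc C"
      using assms(1) by (simp add: unitary_mtc_def)
  next
    fix s t a b c d assume "s \<in> ltrees C a b c d" "t \<in> rtrees C a b c d"
    then have "Fsym C a b c d s t \<in> FR_entries C"
      unfolding FR_entries_def by blast
    then show "Fsym (galois_conj q C) a b c d s t = \<sigma> (Fsym C a b c d s t)"
      by (simp add: galois_conj_def FR)
  next
    fix a b c \<mu> \<nu> assume "\<mu> < Nfus C a b c" "\<nu> < Nfus C b a c"
    then have "Rsym C a b c \<mu> \<nu> \<in> FR_entries C"
      unfolding FR_entries_def by blast
    then show "Rsym (galois_conj q C) a b c \<mu> \<nu> = \<sigma> (Rsym C a b c \<mu> \<nu>)"
      by (simp add: galois_conj_def FR)
  qed (simp_all add: galois_conj_def)
  interpret conjugate_algebra \<sigma> C "galois_conj q C" A B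
    by unfold_locales (simp_all add: \<sigma> conj_mor_def)
  \<comment> \<open>The bijection sends a class of modules to the set of their conjugates; it is
    onto by \<open>simple_excitations_conj\<close> and injective because \<open>conj_mod\<close>
    is.\<close>
  have "bij_betw ((`) conj_mod) (simple_excitations C A) (simple_excitations (galois_conj q C) B)"
    unfolding simple_excitations_conj
    by (intro inj_on_imp_bij_betw inj_onI) (simp add: inj_image_eq_iff[OF inj_conj_mod])
  then show ?thesis
    by (intro conjI exI[of _ "(`) conj_mod"] ballI lagrangian_algebra_conj assms(5)
        boundary_fusion_conj)
qed

end
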